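(* Let $\mathscr{H}$ be a reproducing kernel Hilbert space on a non-empty set $\mathscr{X}$, let $T,S\in\mathscr{B}(\mathscr{H})$ and let $\theta\in[0,\frac{\pi}{2})$ be such that $S^*T\in\Pi^{\mathbf{Ber}}_{\theta}$. If $S$ is invertible (with bounded inverse), then $$\big\||T|^2\big\|_{ber}^{1/2}\ \le\ \|S^{-1}\|\Big(\sin\theta\ \mathbf{ber}(S^*T)+\frac12\big\||T-iS|^2\big\|_{ber}\Big).$$
   Context: $\mathscr{H}$ is a complex separable reproducing kernel Hilbert space of complex-valued functions on a non-empty set $\mathscr{X}$: for every $\lambda\in\mathscr{X}$ evaluation at $\lambda$ is continuous, and $k_\lambda\in\mathscr{H}$ denotes the reproducing kernel, $\phi(\lambda)=\langle\phi,k_\lambda\rangle$ for all $\phi\in\mathscr{H}$. It is implicit that $k_\lambda\neq0$, and $\hat k_\lambda=k_\lambda/\|k_\lambda\|$. $\mathscr{B}(\mathscr{H})$ is the algebra of bounded linear operators on $\mathscr{H}$ and $\|\cdot\|$ is the operator norm. For $A\in\mathscr{B}(\mathscr{H})$: $|A|=(A^*A)^{1/2}$; the Berezin transform is $\widetilde A(\lambda)=\langle A\hat k_\lambda,\hat k_\lambda\rangle$; the Berezin range is $\mathbf{Ber}(A)=\{\widetilde A(\lambda):\lambda\in\mathscr{X}\}$; the Berezin number is $\mathbf{ber}(A)=\sup_{\lambda\in\mathscr{X}}|\widetilde A(\lambda)|$; the Berezin norm is $\|A\|_{ber}=\sup_{\lambda,\mu\in\mathscr{X}}|\langle A\hat k_\lambda,\hat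 k_\mu\rangle|$. For $\theta\in[0,\frac{\pi}{2})$, $S_\theta=\{z\in\mathbb{C}:|\arg z|\le\theta\}$ is the sector with vertex at the origin (vertex included) and semi-angle $\theta$, and $\Pi^{\mathbf{Ber}}_\theta$ is the class of $A\in\mathscr{B}(\mathscr{H})$ with $\mathbf{Ber}(A)\subseteq S_\theta$. A known fact: $\|A\|_{ber}=\mathbf{ber}(A)$ for positive operators $A$. *)

theory Defs
  imports "HOL-Analysis.Analysis"
begin

class scaleC =
  fixes scaleC :: "complex \<Rightarrow> 'a \<Rightarrow> 'a"  (infixr \<open>*\<^sub>C\<close> 75)

(* A complex inner product space, built on its underlying real inner product space so that
   norm, topology, completeness and operator norm are those of the library. The axiom inner_cinner
   makes the norm the one induced by cinner and makes cinner positive definite; see cinner_self.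
   The inner product is linear in its first argument. *)
class complex_inner = real_inner + scaleC +
  fixes cinner :: "'a \<Rightarrow> 'a \<Rightarrow> complex"
  assumes scaleC_add_right: "a *\<^sub>C (x + y) = a *\<^sub>C x + a *\<^sub>C y"
    and scaleC_add_left: "(a + b) *\<^sub>C x = a *\<^sub>C x + b *\<^sub>C x"
    and scaleC_scaleC: "a *\<^sub>C b *\<^sub>C x = (a * b) *\<^sub>C x"
    and scaleR_scaleC: "r *\<^sub>R x = complex_of_real r *\<^sub>C x"
    and cinner_commute: "cinner x y = cnj (cinner y x)"
    and cinner_add_left: "cinner (x + y) z = cinner x z + cinner y z"
    and cinner_scaleC_left: "cinner (a *\<^sub>C x) y = a * cinner x y"
    and inner_cinner: "inner x y = Re (cinner x y)"

lemma cinner_self: "cinner x x = complex_of_real ((norm x)\<^sup>2)"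
proof -
  have "Im (cinner x x) = - Im (cinner x x)"
    using arg_cong [OF cinner_commute [of x x], of Im] by simp
  moreover have "Re (cinner x x) = (norm x)\<^sup>2"
    by (simp add: inner_cinner [symmetric] power2_norm_eq_inner)
  ultimately show ?thesis
    by (simp add: complex_eq_iff)
qed

class complex_hilbert = complex_inner + complete_space

definition bounded_clinear :: "('h::complex_inner \<Rightarrow> 'h) \<Rightarrow> bool" where
  "bounded_clinear A \<longleftrightarrow> bounded_linear A \<and> (\<forall>c x. A (c *\<^sub>C x) = c *\<^sub>C A x)"

definition cadjoint :: "('h::complex_hilbert \<Rightarrow> 'h) \<Rightarrow> 'h \<Rightarrow> 'h" where
  "cadjoint A = (THE B. \<forall>x y. cinner (A x) y = cinner x (B y))"

definition positive_op :: "('h::complex_hilbert \<Rightarrow> 'h) \<Rightarrow> bool" where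
  "positive_op A \<longleftrightarrow> bounded_clinear A \<and> (\<forall>x. cinner (A x) x \<in> \<real>\<^sub>\<ge>\<^sub>0)"

definition sqrt_op :: "('h::complex_hilbert \<Rightarrow> 'h) \<Rightarrow> 'h \<Rightarrow> 'h" where
  "sqrt_op A = (THE P. positive_op P \<and> P \<circ> P = A)"

definition abs_op :: "('h::complex_hilbert \<Rightarrow> 'h) \<Rightarrow> 'h \<Rightarrow> 'h" where
  "abs_op A = sqrt_op (cadjoint A \<circ> A)"

definition reproducing_kernel :: "('h::complex_hilbert \<Rightarrow> 'x \<Rightarrow> complex) \<Rightarrow> 'x \<Rightarrow> 'h" where
  "reproducing_kernel ev l = (THE k. \<forall>f. ev f l = cinner f k)"

(* The Hilbert space of functions on X is the type 'h, and ev f l is the value f(l): the axioms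
   ev_add, ev_scaleC and ev_inject say that the elements of 'h are functions on X with the
   pointwise vector space operations. Values of ev outside X are irrelevant. *)
locale rkhs =
  fixes X :: "'x set" and ev :: "'h::complex_hilbert \<Rightarrow> 'x \<Rightarrow> complex"
  assumes nonempty: "X \<noteq> {}"
    and separable: "separable_space (euclidean :: 'h topology)"
    and ev_add: "l \<in> X \<Longrightarrow> ev (f + g) l = ev f l + ev g l"
    and ev_scaleC: "l \<in> X \<Longrightarrow> ev (c *\<^sub>C f) l = c * ev f l"
    and ev_inject: "(\<And>l. l \<in> X \<Longrightarrow> ev f l = ev g l) \<Longrightarrow> f = g"
    and ev_continuous: "l \<in> X \<Longrightarrow> continuous_on UNIV (\<lambda>f. ev f l)"
    and kernel_nonzero: "l \<in> X \<Longrightarrow> reproducing_kernel ev l \<noteq> 0"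

definition normalized_kernel :: "('h::complex_hilbert \<Rightarrow> 'x \<Rightarrow> complex) \<Rightarrow> 'x \<Rightarrow> 'h" where
  "normalized_kernel ev l = reproducing_kernel ev l /\<^sub>R norm (reproducing_kernel ev l)"

definition berezin_transform ::
  "('h::complex_hilbert \<Rightarrow> 'x \<Rightarrow> complex) \<Rightarrow> ('h \<Rightarrow> 'h) \<Rightarrow> 'x \<Rightarrow> complex" where
  "berezin_transform ev A l = cinner (A (normalized_kernel ev l)) (normalized_kernel ev l)"

definition berezin_range ::
  "'x set \<Rightarrow> ('h::complex_hilbert \<Rightarrow> 'x \<Rightarrow> complex) \<Rightarrow> ('h \<Rightarrow> 'h) \<Rightarrow> complex set" where
  "berezin_range X ev A = berezin_transform ev A ` X"

definition berezin_number ::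
  "'x set \<Rightarrow> ('h::complex_hilbert \<Rightarrow> 'x \<Rightarrow> complex) \<Rightarrow> ('h \<Rightarrow> 'h) \<Rightarrow> real" where
  "berezin_number X ev A = (SUP l\<in>X. cmod (berezin_transform ev A l))"

definition berezin_norm ::
  "'x set \<Rightarrow> ('h::complex_hilbert \<Rightarrow> 'x \<Rightarrow> complex) \<Rightarrow> ('h \<Rightarrow> 'h) \<Rightarrow> real" where
  "berezin_norm X ev A =
    (SUP (l, m)\<in>X \<times> X. cmod (cinner (A (normalized_kernel ev l)) (normalized_kernel ev m)))"

(* The vertex is included for \<theta> \<ge> 0, as Arg 0 = 0. *)
definition sector :: "real \<Rightarrow> complex set" where
  "sector \<theta> = {z. \<bar>Arg z\<bar> \<le> \<theta>}"

definition berezin_sectorial ::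
  "'x set \<Rightarrow> ('h::complex_hilbert \<Rightarrow> 'x \<Rightarrow> complex) \<Rightarrow> real \<Rightarrow> ('h \<Rightarrow> 'h) set" where
  "berezin_sectorial X ev \<theta> = {A. bounded_clinear A \<and> berezin_range X ev A \<subseteq> sector \<theta>}"

end

theory Submission
  imports Defs
begin

text \<open>For a normalized kernel \<open>k\<close>, expanding the square gives
  \<open>\<parallel>(T - \<i>S)k\<parallel>\<^sup>2 = \<parallel>Tk\<parallel>\<^sup>2 + \<parallel>Sk\<parallel>\<^sup>2 - 2 Im \<langle>S\<^sup>*Tk, k\<rangle>\<close>. The sectorial condition bounds the
  imaginary part by \<open>sin \<theta> \<cdot> \<bar>\<langle>S\<^sup>*Tk, k\<rangle>\<bar>\<close>, the arithmetic-geometric mean inequality bounds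
  \<open>\<parallel>Tk\<parallel> \<parallel>Sk\<parallel>\<close> from above, and \<open>1 = \<parallel>S\<^sup>-\<^sup>1Sk\<parallel> \<le> \<parallel>S\<^sup>-\<^sup>1\<parallel> \<parallel>Sk\<parallel>\<close> removes the factor \<open>\<parallel>Sk\<parallel>\<close>; finally
  the Berezin norm of \<open>|T|\<^sup>2 = T\<^sup>*T\<close> is the supremum of \<open>\<parallel>Tk\<parallel>\<^sup>2\<close> over the normalized kernels. That
  \<open>|T|\<close> exists rests on the binomial series of \<open>(1 - z)\<^bsup>1/2\<^esup>\<close>, whose coefficients are absolutely
  summable, so that it can be evaluated at any symmetric contraction.\<close>

section \<open>Riesz representation\<close>

instance complex_hilbert \<subseteq> banach ..

lemma riesz_real:
  fixes f :: "'a::{real_inner,banach} \<Rightarrow> real"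
  assumes f: "bounded_linear f"
  obtains z where "\<And>x. f x = inner x z"
proof -
  interpret bounded_linear f by fact
  \<comment> \<open>\<open>z\<close> is the minimizer of \<open>J\<close>; by \<open>J_mid\<close>, minimizing sequences are Cauchy.\<close>
  define J where "J x = (norm x)\<^sup>2 - 2 * f x" for x
  have J_mid: "(norm (x - y))\<^sup>2 / 2 = J x + J y - 2 * J ((1/2) *\<^sub>R (x + y))" for x y
    by (simp add: J_def power2_norm_eq_inner algebra_simps inner_commute add scaleR field_simps)
  obtain K where K: "\<And>x. norm (f x) \<le> norm x * K" using bounded by blast
  have J_ge: "- K\<^sup>2 \<le> J x" for x
  proof -
    have "f x \<le> norm x * K" using K[of x] by simp
    moreover have "0 \<le> (norm x - K)\<^sup>2" by simp
    ultimately show ?thesis by (simp add: J_def power2_eq_square algebra_simps)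
  qed
  then have bdd: "bdd_below (range J)" by (rule bdd_belowI2)
  define m where "m = Inf (range J)"
  have m_le: "m \<le> J x" for x unfolding m_def by (rule cInf_lower) (use bdd in auto)
  have "\<exists>x. J x < m + inverse (real (Suc n))" for n
    using cInf_lessD[of "range J" "m + inverse (real (Suc n))"] by (auto simp: m_def)
  then obtain u where u: "\<And>n. J (u n) < m + inverse (real (Suc n))" by metis
  have lim0: "(\<lambda>n. inverse (real (Suc n))) \<longlonglongrightarrow> 0" by (rule LIMSEQ_inverse_real_of_nat)
  have close: "(norm (u i - u j))\<^sup>2 < 2 * (inverse (real (Suc i)) + inverse (real (Suc j)))" for i j
    using J_mid[of "u i" "u j"] u[of i] u[of j] m_le[of "(1/2) *\<^sub>R (u i + u j)"]
    by argo
  have "Cauchy u"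
  proof (rule CauchyI)
    fix e :: real assume e: "0 < e"
    then have "0 < e\<^sup>2 / 4" by simp
    from order_tendstoD(2)[OF lim0 this] obtain N where
      N: "\<And>n. n \<ge> N \<Longrightarrow> inverse (real (Suc n)) < e\<^sup>2 / 4" by (auto simp: eventually_sequentially)
    have "norm (u i - u j) < e" if "i \<ge> N" "j \<ge> N" for i j
    proof (rule power2_less_imp_less)
      show "(norm (u i - u j))\<^sup>2 < e\<^sup>2" using close[of i j] N[OF that(1)] N[OF that(2)] by argo
    qed (use e in simp)
    then show "\<exists>M. \<forall>m\<ge>M. \<forall>n\<ge>M. norm (u m - u n) < e" by blast
  qed
  then obtain z where z: "u \<longlonglongrightarrow> z" using Cauchy_convergent convergent_def by blast
  have "(\<lambda>n. J (u n)) \<longlonglongrightarrow> J z"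
    unfolding J_def by (intro tendsto_intros tendsto z)
  moreover have "(\<lambda>n. m + inverse (real (Suc n))) \<longlonglongrightarrow> m + 0" by (intro tendsto_intros lim0)
  ultimately have "J z \<le> m + 0"
    by (rule LIMSEQ_le) (use u less_imp_le in blast)
  then have J_min: "J z \<le> J x" for x using m_le[of x] by simp
  have "f v = inner v z" for v
  proof -
    \<comment> \<open>Up to a factor 2, \<open>a\<close> is the derivative of \<open>J\<close> at
      \<open>z\<close> along \<open>v\<close>. Moving from \<open>z\<close> by
      \<open>- a / b\<close>, nearly the minimizing step, would lower \<open>J\<close> unless
      \<open>a = 0\<close>. The \<open>+ 1\<close> in \<open>b\<close> covers
      \<open>v = 0\<close>.\<close>
    define a where "a = inner v z - f v"
    define b where "b = (norm v)\<^sup>2 + 1"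
    have b: "0 < b" unfolding b_def by (smt (verit) zero_le_power2)
    have "J (z + t *\<^sub>R v) = J z + 2 * t * a + t * t * (norm v)\<^sup>2" for t
      by (simp add: J_def a_def power2_norm_eq_inner algebra_simps inner_commute add scaleR)
    from this[of "- a / b"] J_min[of "z + (- a / b) *\<^sub>R v"]
    have "0 \<le> 2 * (- a / b) * a + (- a / b) * (- a / b) * (b - 1)" by (simp add: b_def)
    also have "\<dots> = - (a\<^sup>2 / b) * (1 + 1 / b)"
      using b by (simp add: field_simps power2_eq_square)
    finally have "a\<^sup>2 / b * (1 + 1 / b) \<le> 0" by simp
    moreover have "0 < 1 + 1 / b" using b by (simp add: add_pos_pos)
    ultimately have "a\<^sup>2 \<le> 0" using b by (simp add: mult_le_0_iff divide_le_0_iff)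
    then show ?thesis by (simp add: a_def)
  qed
  then show thesis by (rule that)
qed

section \<open>The binomial series for the square root\<close>

definition sqrt_coeff :: "nat \<Rightarrow> real" where
  "sqrt_coeff n = (- 1) ^ n * ((1 / 2) gchoose n)"

lemma sqrt_coeff_0 [simp]: "sqrt_coeff 0 = 1"
  by (simp add: sqrt_coeff_def)

lemma sqrt_coeff_Suc: "sqrt_coeff (Suc n) = sqrt_coeff n * (real n - 1 / 2) / (real n + 1)"
proof -
  have "((1 / 2) gchoose Suc n) = ((1 / 2 :: real) gchoose n) * ((1 / 2 - real n) / (real n + 1))"
    using gbinomial_mult_1[of "1/2 :: real" n] by (simp add: field_simps)
  then show ?thesis
    by (simp only: sqrt_coeff_def power_Suc) (simp add: divide_simps, simp add: algebra_simps)
qed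

text \<open>Induction through the ratio of consecutive coefficients. The closed form turns the sign
  of a single coefficient into the sign of a partial sum.\<close>

lemma sum_sqrt_coeff: "(\<Sum>k\<le>n. sqrt_coeff k) = - 2 * (real n + 1) * sqrt_coeff (Suc n)"
proof (induction n)
  case 0
  then show ?case by (simp add: sqrt_coeff_Suc)
next
  case (Suc n)
  have "(\<Sum>k\<le>Suc n. sqrt_coeff k) = - (2 * real n + 1) * sqrt_coeff (Suc n)"
    using Suc by (simp add: algebra_simps)
  also have "\<dots> = - 2 * (real (Suc n) + 1) * sqrt_coeff (Suc (Suc n))"
    by (simp add: sqrt_coeff_Suc[of "Suc n"] field_simps)
  finally show ?case .
qed

text \<open>The ratio \<open>(n - 1/2) / (n + 1)\<close> is negative only at \<open>n = 0\<close>,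
  where it turns 1 into -1/2; afterwards the sign persists.\<close>

lemma sqrt_coeff_Suc_nonpos: "sqrt_coeff (Suc n) \<le> 0"
proof (induction n)
  case 0
  then show ?case by (simp add: sqrt_coeff_Suc)
next
  case (Suc n)
  then show ?case
    by (subst sqrt_coeff_Suc) (simp add: divide_nonpos_pos mult_nonpos_nonneg)
qed

lemma sum_sqrt_coeff_nonneg: "0 \<le> (\<Sum>k\<le>n. sqrt_coeff k)"
  unfolding sum_sqrt_coeff using sqrt_coeff_Suc_nonpos[of n] by (simp add: mult_nonpos_nonpos)

lemma summable_abs_sqrt_coeff: "summable (\<lambda>n. \<bar>sqrt_coeff n\<bar>)"
proof (rule summableI_nonneg_bounded[where x = 2])
  fix n
  \<comment> \<open>Only the term at \<open>k = 0\<close>, equal to 1, is positive, so taking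
    absolute values reflects the partial sum about 1.\<close>
  have *: "(\<Sum>k\<le>m. \<bar>sqrt_coeff k\<bar>) = 2 - (\<Sum>k\<le>m. sqrt_coeff k)" for m
    by (induction m) (use sqrt_coeff_Suc_nonpos in \<open>auto simp: abs_of_nonpos\<close>)
  show "(\<Sum>k<n. \<bar>sqrt_coeff k\<bar>) \<le> 2"
    using *[of "n - 1"] sum_sqrt_coeff_nonneg[of "n - 1"]
    by (cases n) (auto simp: lessThan_Suc_atMost)
qed simp

lemma summable_on_abs_sqrt_coeff: "(\<lambda>n. \<bar>sqrt_coeff n\<bar>) summable_on UNIV"
  by (rule norm_summable_imp_summable_on) (simp add: summable_abs_sqrt_coeff)

text \<open>Squaring the series of \<open>sqrt (1 - z)\<close> must return \<open>1 - z\<close>; on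
  coefficients this is Vandermonde with 1/2 + 1/2 = 1.\<close>

lemma sqrt_coeff_convolution:
  "(\<Sum>k\<le>n. sqrt_coeff k * sqrt_coeff (n - k)) = (if n = 0 then 1 else if n = 1 then - 1 else 0)"
proof -
  have "(\<Sum>k\<le>n. sqrt_coeff k * sqrt_coeff (n - k))
    = (- 1) ^ n * (\<Sum>k\<le>n. ((1/2) gchoose k) * ((1/2) gchoose (n - k)))"
    unfolding sum_distrib_left
    by (rule sum.cong) (auto simp: sqrt_coeff_def power_add[symmetric] mult_ac)
  also have "\<dots> = (- 1) ^ n * ((1 :: real) gchoose n)"
    using gbinomial_Vandermonde[of "1/2::real" "1/2" n] by (simp add: atMost_atLeast0)
  also have "(1 :: real) gchoose n = of_nat (1 choose n)"
    using binomial_gbinomial[of 1 n, where 'a = real] by simp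
  finally show ?thesis by (cases n) (auto simp: binomial_eq_0_iff)
qed

section \<open>Positive square roots on a real Hilbert space\<close>

text \<open>Linearity follows from nondegeneracy of the inner product, the bound by cancelling
  \<open>norm (B y)\<close> after Cauchy-Schwarz on \<open>inner (A (B y)) y\<close>.\<close>

lemma bounded_linear_adjoint:
  fixes A B :: "'a::real_inner \<Rightarrow> 'a"
  assumes A: "bounded_linear A" and AB: "\<And>x y. inner (A x) y = inner x (B y)"
  shows "bounded_linear B" and "norm (B y) \<le> onorm A * norm y"
proof -
  have bound: "norm (B y) \<le> onorm A * norm y" for y
  proof (cases "B y = 0")
    case True
    then show ?thesis using onorm_pos_le[OF A] by simp
  next
    case False
    have "norm (B y) * norm (B y) = inner (A (B y)) y"
      by (simp add: AB power2_norm_eq_inner[symmetric] power2_eq_square)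
    also have "\<dots> \<le> norm (A (B y)) * norm y" by (rule norm_cauchy_schwarz)
    also have "\<dots> \<le> (onorm A * norm (B y)) * norm y"
      by (intro mult_right_mono onorm[OF A]) simp
    finally have "norm (B y) * norm (B y) \<le> norm (B y) * (onorm A * norm y)"
      by (simp add: mult_ac)
    then show ?thesis using False by simp
  qed
  show "norm (B y) \<le> onorm A * norm y" by (rule bound)
  show "bounded_linear B"
  proof (rule bounded_linear_intro)
    show "B (x + y) = B x + B y" for x y
      by (rule vector_eq_ldot[THEN iffD1]) (simp add: AB[symmetric] inner_add_right)
    show "B (r *\<^sub>R x) = r *\<^sub>R B x" for r x
      by (rule vector_eq_ldot[THEN iffD1]) (simp add: AB[symmetric])
    show "norm (B x) \<le> norm x * onorm A" for x using bound[of x] by (simp add: mult.commute)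
  qed
qed

text \<open>Testing the vanishing form at \<open>x + A x\<close> leaves only the cross terms, twice
  the squared norm of \<open>A x\<close>.\<close>

lemma symmetric_eq_zero:
  fixes A :: "'a::real_inner \<Rightarrow> 'a"
  assumes "bounded_linear A" and sym: "\<And>x y. inner (A x) y = inner x (A y)"
    and null: "\<And>x. inner (A x) x = 0"
  shows "A x = 0"
proof -
  interpret bounded_linear A by fact
  have "inner (A (x + A x)) (x + A x) = 2 * inner (A x) (A x)"
    using null[of x] null[of "A x"] by (simp add: add inner_add_left inner_add_right sym)
  then show ?thesis by (simp add: null)
qed

text \<open>With \<open>D = P - Q\<close> one has \<open>D P D + D Q D = (P\<^sup>2 - Q\<^sup>2) D = 0\<close>, a sum of two positive
  operators, so both vanish and with them their difference \<open>D\<^sup>3\<close>.\<close>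

lemma positive_sqrt_unique:
  fixes P Q :: "'a::real_inner \<Rightarrow> 'a"
  assumes P: "bounded_linear P" "\<And>x y. inner (P x) y = inner x (P y)" "\<And>x. 0 \<le> inner (P x) x"
    and Q: "bounded_linear Q" "\<And>x y. inner (Q x) y = inner x (Q y)" "\<And>x. 0 \<le> inner (Q x) x"
    and square: "\<And>x. P (P x) = Q (Q x)" and commute: "\<And>x. P (Q x) = Q (P x)"
  shows "P x = Q x"
proof -
  interpret P: bounded_linear P by fact
  interpret Q: bounded_linear Q by fact
  define D where "D x = P x - Q x" for x
  have D: "bounded_linear D" unfolding D_def by (intro bounded_linear_sub P Q)
  interpret D: bounded_linear D by fact
  have D_sym: "inner (D x) y = inner x (D y)" for x y
    by (simp add: D_def inner_diff_left inner_diff_right P(2) Q(2))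
  have "inner (P (D x)) (D x) + inner (Q (D x)) (D x) = 0" for x
  proof -
    have "D (P (D x) + Q (D x)) = 0"
      by (simp add: D_def P.add Q.add P.diff Q.diff square commute)
    then have "inner (D (P (D x) + Q (D x))) x = 0" by simp
    then show ?thesis by (simp add: D_sym inner_add_left)
  qed
  then have "inner (P (D x)) (D x) = 0" "inner (Q (D x)) (D x) = 0" for x
    using P(3)[of "D x"] Q(3)[of "D x"] by (smt (verit))+
  moreover have "inner (D (D (D x))) x = inner (P (D x)) (D x) - inner (Q (D x)) (D x)" for x
    unfolding D_sym[of "D (D x)" x] by (simp add: D_def[of "D x"] inner_diff_left)
  ultimately have "inner (D (D (D x))) x = 0" for x by simp
  then have "D (D (D x)) = 0" for x
    by (intro symmetric_eq_zero[of "\<lambda>x. D (D (D x))"])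
      (simp_all add: D_sym bounded_linear_compose[OF D bounded_linear_compose[OF D D]])
  \<comment> \<open>Symmetry of \<open>D\<close> lowers the exponent from 3 to 1: the squared norm
    of \<open>D (D x)\<close> is \<open>inner (D x) (D (D (D x)))\<close>, and that of
    \<open>D x\<close> is \<open>inner x (D (D x))\<close>.\<close>
  from this[of x] have "inner (D (D x)) (D (D x)) = 0" by (simp add: D_sym[of "D x"])
  then have "inner (D x) (D x) = 0" by (simp add: D_sym[of x])
  then show ?thesis by (simp add: D_def)
qed

section \<open>Evaluating the binomial series at a symmetric contraction\<close>

locale symmetric_contraction =
  fixes B :: "'a::{real_inner,banach} \<Rightarrow> 'a"
  assumes linear: "bounded_linear B"
    and symmetric: "inner (B x) y = inner x (B y)"
    and contraction: "norm (B x) \<le> norm x"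
begin

text \<open>The positive square root of \<open>x \<mapsto> x - B x\<close>.\<close>

definition root :: "'a \<Rightarrow> 'a" where
  "root x = (\<Sum>\<^sub>\<infinity>n. sqrt_coeff n *\<^sub>R (B ^^ n) x)"

lemma linear_power: "bounded_linear (B ^^ n)"
  by (induction n) (auto intro: bounded_linear_compose[OF linear] bounded_linear_ident simp: id_def comp_def)

lemma symmetric_power: "inner ((B ^^ n) x) y = inner x ((B ^^ n) y)"
  by (induction n arbitrary: y) (simp, simp add: symmetric, simp add: funpow_swap1)

lemma norm_power_le: "norm ((B ^^ n) x) \<le> norm x"
proof (induction n)
  case (Suc n)
  then show ?case using contraction[of "(B ^^ n) x"] by simp
qed simp

lemma abs_summable_root: "(\<lambda>n. norm (sqrt_coeff n *\<^sub>R (B ^^ n) x)) summable_on UNIV"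
proof (rule Infinite_Sum.abs_summable_on_comparison_test')
  show "(\<lambda>n. \<bar>sqrt_coeff n\<bar> * norm x) summable_on UNIV"
    by (intro summable_on_cmult_left summable_on_abs_sqrt_coeff)
qed (simp add: mult_left_mono norm_power_le)

lemma has_sum_root: "((\<lambda>n. sqrt_coeff n *\<^sub>R (B ^^ n) x) has_sum root x) UNIV"
  unfolding root_def by (rule has_sum_infsum[OF abs_summable_summable[OF abs_summable_root]])

text \<open>A bounded linear map acts term by term on the series, and \<open>C\<close> passes
  through every power of \<open>B\<close>. With \<open>C\<close> a real scalar this also gives
  homogeneity of \<open>root\<close>.\<close>

lemma root_commute:
  assumes C: "bounded_linear C" and commute: "\<And>x. C (B x) = B (C x)"
  shows "C (root x) = root (C x)"
proof -
  interpret C: bounded_linear C by fact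
  have "C ((B ^^ n) x) = (B ^^ n) (C x)" for n by (induction n) (simp_all add: commute)
  then have "((\<lambda>n. sqrt_coeff n *\<^sub>R (B ^^ n) (C x)) has_sum C (root x)) UNIV"
    using has_sum_bounded_linear[OF C has_sum_root[of x]] by (simp add: C.scaleR)
  then show ?thesis by (rule has_sum_unique[OF _ has_sum_root])
qed

lemma inner_root:
  "((\<lambda>n. sqrt_coeff n * inner ((B ^^ n) x) y) has_sum inner (root x) y) UNIV"
  using has_sum_bounded_linear[OF bounded_linear_inner_left has_sum_root[of x]] by simp

lemma symmetric_root: "inner (root x) y = inner x (root y)"
proof -
  have "inner ((B ^^ n) x) y = inner ((B ^^ n) y) x" for n
    by (metis symmetric_power inner_commute)
  then have "inner (root x) y = inner (root y) x"
    using inner_root[of x y] inner_root[of y x] by (intro has_sum_unique[OF inner_root]) simp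
  then show ?thesis by (simp add: inner_commute)
qed

lemma norm_root_le: "norm (root x) \<le> norm x * (\<Sum>\<^sub>\<infinity>n. \<bar>sqrt_coeff n\<bar>)"
  by (rule norm_infsum_le[OF has_sum_root
        has_sum_cmult_right[OF has_sum_infsum[OF summable_on_abs_sqrt_coeff]]])
    (simp add: mult.commute[of "norm x"] mult_left_mono norm_power_le)

lemma bounded_linear_root: "bounded_linear root"
proof (rule bounded_linear_intro[OF _ _ norm_root_le])
  interpret P: bounded_linear "B ^^ n" for n by (rule linear_power)
  show "root (x + y) = root x + root y" for x y
    using has_sum_add[OF has_sum_root[of x] has_sum_root[of y]]
    by (intro has_sum_unique[OF has_sum_root]) (simp add: P.add scaleR_add_right)
  show "root (r *\<^sub>R x) = r *\<^sub>R root x" for r x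
    by (rule root_commute[symmetric])
      (auto intro: bounded_linear_scaleR_right simp: linear_simps[OF linear])
qed

text \<open>Beyond index 0 the coefficients are nonpositive and \<open>inner ((B ^^ k) x) x\<close>
  is at most the squared norm of \<open>x\<close>. Hence each partial sum dominates that squared
  norm times a nonnegative partial sum of coefficients.\<close>

lemma root_nonneg: "0 \<le> inner (root x) x"
proof (rule LIMSEQ_le_const)
  show "(\<lambda>n. \<Sum>k<n. sqrt_coeff k * inner ((B ^^ k) x) x) \<longlonglongrightarrow> inner (root x) x"
    using has_sum_imp_sums[OF inner_root] by (simp add: sums_def)
  have "sqrt_coeff k * (norm x)\<^sup>2 \<le> sqrt_coeff k * inner ((B ^^ k) x) x" for k
  proof (cases k)
    case 0
    then show ?thesis by (simp add: power2_norm_eq_inner)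
  next
    case (Suc m)
    have "inner ((B ^^ k) x) x \<le> norm ((B ^^ k) x) * norm x" by (rule norm_cauchy_schwarz)
    also have "\<dots> \<le> (norm x)\<^sup>2"
      by (simp add: power2_eq_square mult_right_mono norm_power_le)
    finally show ?thesis
      using sqrt_coeff_Suc_nonpos[of m] by (simp add: Suc mult_left_mono_neg)
  qed
  then have "(\<Sum>k\<le>n. sqrt_coeff k) * (norm x)\<^sup>2 \<le> (\<Sum>k\<le>n. sqrt_coeff k * inner ((B ^^ k) x) x)" for n
    unfolding sum_distrib_right by (rule sum_mono)
  then have "0 \<le> (\<Sum>k\<le>n. sqrt_coeff k * inner ((B ^^ k) x) x)" for n
    using sum_sqrt_coeff_nonneg[of n] by (meson mult_nonneg_nonneg order_trans zero_le_power2)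
  \<comment> \<open>The bound concerns sums over \<open>k \<le> n\<close>, so the sums over
    \<open>k < n\<close> are reached from index 1 on.\<close>
  then show "\<exists>N. \<forall>n\<ge>N. 0 \<le> (\<Sum>k<n. sqrt_coeff k * inner ((B ^^ k) x) x)"
    by (intro exI[of _ 1] allI impI) (metis Suc_le_D One_nat_def lessThan_Suc_atMost)
qed

text \<open>The absolutely summable double series \<open>f\<close> is summed in two ways: rows give
  \<open>root (root x)\<close>, and the antidiagonals \<open>i + j = n\<close> give the convolution
  of the coefficients.\<close>

lemma root_root: "root (root x) = x - B x"
proof -
  define f where "f = (\<lambda>(i, j). (sqrt_coeff i * sqrt_coeff j) *\<^sub>R (B ^^ (i + j)) x)"
  have "(\<lambda>(i, j). \<bar>sqrt_coeff i\<bar> * \<bar>sqrt_coeff j\<bar>) summable_on UNIV \<times> UNIV"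
  proof (rule summable_on_SigmaI)
    show "((\<lambda>j. case (i, j) of (i, j) \<Rightarrow> \<bar>sqrt_coeff i\<bar> * \<bar>sqrt_coeff j\<bar>) has_sum
        \<bar>sqrt_coeff i\<bar> * (\<Sum>\<^sub>\<infinity>j. \<bar>sqrt_coeff j\<bar>)) UNIV" for i
      using has_sum_cmult_right[OF has_sum_infsum[OF summable_on_abs_sqrt_coeff]] by simp
    show "(\<lambda>i. \<bar>sqrt_coeff i\<bar> * (\<Sum>\<^sub>\<infinity>j. \<bar>sqrt_coeff j\<bar>)) summable_on UNIV"
      by (intro summable_on_cmult_left summable_on_abs_sqrt_coeff)
  qed auto
  then have "(\<lambda>p. (case p of (i, j) \<Rightarrow> \<bar>sqrt_coeff i\<bar> * \<bar>sqrt_coeff j\<bar>) * norm x) summable_on UNIV \<times> UNIV"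
    by (rule summable_on_cmult_left)
  then have "(\<lambda>p. norm (f p)) summable_on UNIV \<times> UNIV"
    by (rule Infinite_Sum.abs_summable_on_comparison_test')
      (auto simp: f_def abs_mult intro!: mult_left_mono norm_power_le)
  then have "f summable_on UNIV \<times> UNIV" by (rule abs_summable_summable)
  then obtain l where l: "(f has_sum l) (UNIV \<times> UNIV)" by (auto simp: summable_on_def)
  have row: "((\<lambda>j. f (i, j)) has_sum sqrt_coeff i *\<^sub>R (B ^^ i) (root x)) UNIV" for i
  proof -
    interpret P: bounded_linear "B ^^ i" by (rule linear_power)
    have "bounded_linear (\<lambda>y. sqrt_coeff i *\<^sub>R (B ^^ i) y)"
      by (intro bounded_linear_const_scaleR linear_power)
    from has_sum_bounded_linear[OF this has_sum_root] show ?thesis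
      by (simp add: f_def P.scaleR funpow_add)
  qed
  have "((\<lambda>i. sqrt_coeff i *\<^sub>R (B ^^ i) (root x)) has_sum l) UNIV"
    by (rule has_sum_SigmaD[OF l row])
  then have 1: "root (root x) = l" using has_sum_root has_sum_unique by blast
  define g where "g = (\<lambda>(n, i). f (i, n - i))"
  have "bij_betw (\<lambda>(n, i). (i, n - i)) (SIGMA n:UNIV. {..n}) (UNIV \<times> (UNIV :: nat set))"
    by (rule bij_betwI[of _ _ _ "\<lambda>(i, j). (i + j, i)"]) auto
  from has_sum_reindex_bij_betw[OF this, of f l] l have "(g has_sum l) (SIGMA n:UNIV. {..n})"
    by (simp add: g_def case_prod_unfold)
  then have "((\<lambda>n. \<Sum>i\<le>n. g (n, i)) has_sum l) UNIV"
    by (rule has_sum_SigmaD) (auto intro: has_sum_finite)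
  \<comment> \<open>The factor \<open>1 - 2 * real n\<close> encodes the two surviving convolution
    values, 1 at \<open>n = 0\<close> and -1 at \<open>n = 1\<close>.\<close>
  moreover have "(\<Sum>i\<le>n. g (n, i)) = (if n \<in> {0, 1} then (1 - 2 * real n) *\<^sub>R (B ^^ n) x else 0)" for n
  proof -
    have "(\<Sum>i\<le>n. g (n, i)) = (\<Sum>i\<le>n. sqrt_coeff i * sqrt_coeff (n - i)) *\<^sub>R (B ^^ n) x"
      by (simp add: g_def f_def scaleR_sum_left)
    then show ?thesis by (simp add: sqrt_coeff_convolution)
  qed
  ultimately have "((\<lambda>n. if n \<in> {0, 1} then (1 - 2 * real n) *\<^sub>R (B ^^ n) x else 0) has_sum l) UNIV"
    by simp
  moreover have "((\<lambda>n. if n \<in> {0, 1} then (1 - 2 * real n) *\<^sub>R (B ^^ n) x else 0) has_sum (x - B x)) UNIV"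
    using has_sum_finite_neutralI[of "{0, 1 :: nat}" UNIV
        "\<lambda>n. if n \<in> {0, 1} then (1 - 2 * real n) *\<^sub>R (B ^^ n) x else 0" "x - B x"] by simp
  ultimately show ?thesis using 1 has_sum_unique by blast
qed

end

text \<open>The clause on operators commuting with \<open>T' T\<close> serves twice: with \<open>C\<close> a complex scalar it makes
  \<open>P\<close> complex linear, and with \<open>C\<close> another square root it meets the commutation assumption of
  \<open>positive_sqrt_unique\<close>.\<close>

lemma positive_sqrt_exists:
  fixes T T' :: "'a::{real_inner,banach} \<Rightarrow> 'a"
  assumes T: "bounded_linear T" and adj: "\<And>x y. inner (T x) y = inner x (T' y)"
  obtains P where "bounded_linear P" "\<And>x y. inner (P x) y = inner x (P y)"
    "\<And>x. 0 \<le> inner (P x) x" "\<And>x. P (P x) = T' (T x)"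
    "\<And>C x. bounded_linear C \<Longrightarrow> (\<And>x. C (T' (T x)) = T' (T (C x))) \<Longrightarrow> C (P x) = P (C x)"
proof -
  note T' = bounded_linear_adjoint[OF T adj]
  \<comment> \<open>The \<open>+ 1\<close> keeps \<open>c\<close> positive even for
    \<open>T = 0\<close>. Since \<open>T' (T x)\<close> is \<open>c\<^sup>2\<close> times
    \<open>x - B x\<close>, its root is \<open>c\<close> times \<open>B.root\<close>.\<close>
  define c where "c = onorm T + 1"
  have c: "0 < c" "onorm T \<le> c" using onorm_pos_le[OF T] by (auto simp: c_def)
  define B where "B x = x - (1 / c\<^sup>2) *\<^sub>R T' (T x)" for x
  have inner_T'T: "inner (T' (T x)) y = inner (T x) (T y)" for x y
    by (metis adj inner_commute)
  interpret B: symmetric_contraction B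
  proof (rule symmetric_contraction.intro)
    show "bounded_linear B" unfolding B_def
      by (intro bounded_linear_sub bounded_linear_ident bounded_linear_const_scaleR
          bounded_linear_compose[OF T'(1)] T)
    show "inner (B x) y = inner x (B y)" for x y
      by (simp add: B_def inner_diff_left inner_diff_right inner_T'T adj[symmetric])
    show "norm (B x) \<le> norm x" for x
    proof (rule power2_le_imp_le)
      have "norm (T' (T x)) \<le> c * norm (T x)"
        using T'(2)[of "T x"] c by (meson mult_right_mono norm_ge_zero order_trans)
      then have "(norm (T' (T x)))\<^sup>2 \<le> (c * norm (T x))\<^sup>2" by (rule power_mono) simp
      \<comment> \<open>In the expansion of the squared norm of \<open>B x\<close>, this makes the
        added last term at most half of the subtracted one.\<close>
      then have le: "(norm (T' (T x)))\<^sup>2 / c ^ 4 \<le> (norm (T x))\<^sup>2 / c\<^sup>2"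
        using c(1) by (simp add: field_simps power_mult_distrib power4_eq_xxxx power2_eq_square)
      have "inner x (T' (T x)) = (norm (T x))\<^sup>2"
        by (simp add: power2_norm_eq_inner flip: adj)
      then have "(norm (B x))\<^sup>2
          = (norm x)\<^sup>2 - 2 * ((norm (T x))\<^sup>2 / c\<^sup>2) + (norm (T' (T x)))\<^sup>2 / c ^ 4"
        unfolding power2_norm_eq_inner
        by (simp add: B_def inner_diff_left inner_diff_right inner_commute power4_eq_xxxx power2_eq_square)
      also have "\<dots> \<le> (norm x)\<^sup>2 - 2 * ((norm (T x))\<^sup>2 / c\<^sup>2) + (norm (T x))\<^sup>2 / c\<^sup>2"
        by (intro add_left_mono le)
      also have "\<dots> \<le> (norm x)\<^sup>2" by simp
      finally show "(norm (B x))\<^sup>2 \<le> (norm x)\<^sup>2" .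
    qed simp
  qed
  interpret R: bounded_linear B.root by (rule B.bounded_linear_root)
  show thesis
  proof (rule that[of "\<lambda>x. c *\<^sub>R B.root x"])
    show "bounded_linear (\<lambda>x. c *\<^sub>R B.root x)"
      by (intro bounded_linear_const_scaleR B.bounded_linear_root)
    show "inner (c *\<^sub>R B.root x) y = inner x (c *\<^sub>R B.root y)" for x y
      by (simp add: B.symmetric_root)
    show "0 \<le> inner (c *\<^sub>R B.root x) x" for x using c by (simp add: B.root_nonneg)
    show "c *\<^sub>R B.root (c *\<^sub>R B.root x) = T' (T x)" for x
      using c(1) by (simp add: R.scaleR B.root_root B_def power2_eq_square)
    fix C :: "'a \<Rightarrow> 'a" and x
    assume C: "bounded_linear C" and commute: "\<And>x. C (T' (T x)) = T' (T (C x))"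
    interpret C: bounded_linear C by fact
    have "C (B.root x) = B.root (C x)"
      by (rule B.root_commute[OF C]) (simp add: B_def C.diff C.scaleR commute)
    then show "C (c *\<^sub>R B.root x) = c *\<^sub>R B.root (C x)" by (simp add: C.scaleR)
  qed
qed

section \<open>Operators on a complex Hilbert space\<close>

lemma scaleC_1 [simp]: "1 *\<^sub>C x = (x :: 'a::complex_inner)"
  using scaleR_scaleC[of 1 x] by simp

lemma cinner_scaleC_right: "cinner x (a *\<^sub>C y) = cnj a * cinner x y"
  by (simp add: cinner_commute[of x] cinner_scaleC_left)

text \<open>As Im z = Re(-\<i>z), the real inner product determines the complex one; this carries
  real results over to \<open>cinner\<close>.\<close>

lemma cinner_eq_Complex: "cinner x y = Complex (inner x y) (inner ((- \<i>) *\<^sub>C x) y)"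
  by (simp add: complex_eq_iff inner_cinner cinner_scaleC_left)

lemma inner_ii_ii: "inner ((- \<i>) *\<^sub>C x) (\<i> *\<^sub>C y) = - inner x (y :: 'a::complex_inner)"
  by (simp add: inner_cinner cinner_scaleC_left cinner_scaleC_right)

lemma norm_scaleC: "norm (c *\<^sub>C x) = cmod c * norm (x :: 'a::complex_inner)"
proof -
  have "complex_of_real ((norm (c *\<^sub>C x))\<^sup>2) = c * cnj c * cinner x x"
    by (simp only: cinner_self[symmetric] cinner_scaleC_left cinner_scaleC_right mult_ac)
  also have "\<dots> = complex_of_real ((cmod c * norm x)\<^sup>2)"
    by (simp only: complex_norm_square[symmetric] cinner_self of_real_mult power_mult_distrib)
  finally have "(norm (c *\<^sub>C x))\<^sup>2 = (cmod c * norm x)\<^sup>2" by (simp only: of_real_eq_iff)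
  then show ?thesis by simp
qed

lemma bounded_linear_scaleC: "bounded_linear (\<lambda>x :: 'a::complex_inner. c *\<^sub>C x)"
  by (rule bounded_linear_intro[where K = "cmod c"])
    (simp_all add: scaleC_add_right scaleR_scaleC scaleC_scaleC norm_scaleC mult.commute)

lemma cmod_cinner_le: "cmod (cinner x y) \<le> norm x * norm y"
proof (cases "cinner x y = 0")
  case False
  define z where "z = cinner x y"
  \<comment> \<open>A unimodular phase rotating \<open>z\<close> onto its modulus, which reduces the
    claim to the real Cauchy-Schwarz inequality.\<close>
  define c where "c = cnj z / cmod z"
  have z: "z \<noteq> 0" using False by (simp add: z_def)
  have "cmod z = Re (c * z)"
    using z by (simp add: c_def mult.commute[of "cnj z"] complex_norm_square[symmetric] power2_eq_square
        del: of_real_mult flip: of_real_mult)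
  also have "\<dots> = inner (c *\<^sub>C x) y" by (simp add: inner_cinner cinner_scaleC_left z_def)
  also have "\<dots> \<le> norm (c *\<^sub>C x) * norm y" by (rule norm_cauchy_schwarz)
  also have "norm (c *\<^sub>C x) = norm x" using z by (simp add: norm_scaleC c_def norm_divide)
  finally show ?thesis by (simp add: z_def)
qed simp

text \<open>The description in \<open>cadjoint\<close> needs existence and uniqueness. Riesz gives a
  pointwise adjoint for \<open>inner\<close>; it also serves \<open>cinner\<close> because
  \<open>A\<close> commutes with multiplication by -\<i>.\<close>

lemma cinner_cadjoint:
  fixes A :: "'h::complex_hilbert \<Rightarrow> 'h"
  assumes A: "bounded_clinear A"
  shows "cinner (A x) y = cinner x (cadjoint A y)"
proof -
  have lin: "bounded_linear A" and scale: "\<And>c x. A (c *\<^sub>C x) = c *\<^sub>C A x"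
    using A by (auto simp: bounded_clinear_def)
  have "\<exists>z. \<forall>x. inner (A x) y = inner x z" for y
  proof -
    have "bounded_linear (\<lambda>x. inner (A x) y)"
      by (rule bounded_linear_compose[OF bounded_linear_inner_left lin])
    then show ?thesis by (rule riesz_real) blast
  qed
  then obtain B where B: "\<And>x y. inner (A x) y = inner x (B y)" by metis
  have "\<forall>x y. cinner (A x) y = cinner x (B y)"
    by (simp add: cinner_eq_Complex B scale[symmetric])
  moreover have "C = B" if "\<forall>x y. cinner (A x) y = cinner x (C y)" for C
  proof
    fix y
    have "inner x (C y) = inner x (B y)" for x
      using that B by (metis inner_cinner)
    then show "C y = B y" using vector_eq_ldot by blast
  qed
  ultimately show ?thesis
    unfolding cadjoint_def
    using theI[of "\<lambda>B. \<forall>x y. cinner (A x) y = cinner x (B y)" B] by blast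
qed

lemma cinner_cadjoint_left:
  assumes "bounded_clinear A"
  shows "cinner (cadjoint A x) y = cinner x (A y)"
  using arg_cong[OF cinner_cadjoint[OF assms, of y x], of cnj] by (simp flip: cinner_commute)

text \<open>The bridge to the square root results for \<open>inner\<close>: a real-valued complex
  quadratic form is the same as symmetry, by polarization.\<close>

lemma positive_op_iff:
  "positive_op P \<longleftrightarrow> bounded_clinear P \<and> (\<forall>x y. inner (P x) y = inner x (P y)) \<and> (\<forall>x. 0 \<le> inner (P x) x)"
proof (cases "bounded_clinear P")
  case True
  then interpret bounded_linear P by (simp add: bounded_clinear_def)
  have scale: "P (c *\<^sub>C x) = c *\<^sub>C P x" for c x using True by (simp add: bounded_clinear_def)
  have "(\<forall>x. Im (cinner (P x) x) = 0) \<longleftrightarrow> (\<forall>x y. inner (P x) y = inner x (P y))"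
  proof
    assume real: "\<forall>x. Im (cinner (P x) x) = 0"
    have "inner (P x) y = inner x (P y)" for x y
    proof -
      have null: "inner ((- \<i>) *\<^sub>C P x) x = 0" for x
        using real by (simp add: cinner_eq_Complex)
      \<comment> \<open>The form of -\<i>P vanishes on every vector, so at x + \<i>y only the cross
        terms remain, and they must cancel.\<close>
      have "inner ((- \<i>) *\<^sub>C P (x + \<i> *\<^sub>C y)) (x + \<i> *\<^sub>C y) = - inner (P x) y + inner (P y) x"
        using null[of x] null[of "\<i> *\<^sub>C y"]
        by (simp add: add scaleC_add_right inner_add_left inner_add_right inner_ii_ii scale scaleC_scaleC)
      then show ?thesis by (simp only: null) (simp add: inner_commute)
    qed
    then show "\<forall>x y. inner (P x) y = inner x (P y)" by blast
  next
    assume sym: "\<forall>x y. inner (P x) y = inner x (P y)"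
    have "Im (cinner (P x) x) = Im (cinner x (P x))" for x
      using sym[rule_format, of "(- \<i>) *\<^sub>C x" x] by (simp add: cinner_eq_Complex scale)
    moreover have "Im (cinner x (P x)) = - Im (cinner (P x) x)" for x
      by (subst cinner_commute) simp
    ultimately show "\<forall>x. Im (cinner (P x) x) = 0" by (smt (verit))
  qed
  then show ?thesis
    using True by (auto simp: positive_op_def complex_nonneg_Reals_iff inner_cinner)
qed (simp add: positive_op_def)

text \<open>\<open>sqrt_op\<close> is a definite description, so this amounts to existence and
  uniqueness of the positive root of \<open>cadjoint A \<circ> A\<close>.\<close>

lemma abs_op_power2:
  fixes A :: "'h::complex_hilbert \<Rightarrow> 'h"
  assumes A: "bounded_clinear A"
  shows "abs_op A ^^ 2 = cadjoint A \<circ> A"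
proof -
  have lin: "bounded_linear A" and scale: "\<And>c x. A (c *\<^sub>C x) = c *\<^sub>C A x"
    using A by (auto simp: bounded_clinear_def)
  have adj: "inner (A x) y = inner x (cadjoint A y)" for x y
    by (simp add: inner_cinner cinner_cadjoint[OF A])
  have scale': "cadjoint A (c *\<^sub>C x) = c *\<^sub>C cadjoint A x" for c x
  proof (rule vector_eq_ldot[THEN iffD1], rule allI)
    fix y
    show "inner y (cadjoint A (c *\<^sub>C x)) = inner y (c *\<^sub>C cadjoint A x)"
      by (simp add: inner_cinner cinner_scaleC_right flip: cinner_cadjoint[OF A])
  qed
  obtain P where P: "bounded_linear P" "\<And>x y. inner (P x) y = inner x (P y)"
      "\<And>x. 0 \<le> inner (P x) x" "\<And>x. P (P x) = cadjoint A (A x)"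
    and commute: "\<And>C x. bounded_linear C \<Longrightarrow>
      (\<And>x. C (cadjoint A (A x)) = cadjoint A (A (C x))) \<Longrightarrow> C (P x) = P (C x)"
    using positive_sqrt_exists[OF lin adj] by blast
  have "P (c *\<^sub>C x) = c *\<^sub>C P x" for c x
    by (rule commute[symmetric]) (simp_all add: bounded_linear_scaleC scale scale')
  then have P_sqrt: "positive_op P \<and> P \<circ> P = cadjoint A \<circ> A"
    using P by (auto simp: positive_op_iff bounded_clinear_def)
  have "Q = P" if Q: "positive_op Q \<and> Q \<circ> Q = cadjoint A \<circ> A" for Q
  proof
    fix x
    have QQ: "Q (Q x) = cadjoint A (A x)" for x using Q by (metis comp_apply)
    have Q': "bounded_linear Q" "\<And>x y. inner (Q x) y = inner x (Q y)" "\<And>x. 0 \<le> inner (Q x) x"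
      using Q by (auto simp: positive_op_iff bounded_clinear_def)
    have "Q (P x) = P (Q x)" for x by (rule commute[OF Q'(1)]) (simp flip: QQ)
    then show "Q x = P x" by (rule positive_sqrt_unique[OF Q' P(1-3), rotated]) (simp add: QQ P(4))
  qed
  with P_sqrt have "abs_op A \<circ> abs_op A = cadjoint A \<circ> A"
    unfolding abs_op_def sqrt_op_def
    using theI[of "\<lambda>P. positive_op P \<and> P \<circ> P = cadjoint A \<circ> A" P] by blast
  then show ?thesis by (simp add: numeral_2_eq_2)
qed

section \<open>Berezin norm and sectorial operators\<close>

lemma norm_normalized_kernel:
  assumes "rkhs X ev" and "l \<in> X"
  shows "norm (normalized_kernel ev l) = 1"
  using rkhs.kernel_nonzero[OF assms] by (simp add: normalized_kernel_def)

lemma cmod_cinner_kernel_le: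
  assumes rkhs: "rkhs X ev" and A: "bounded_clinear A" and B: "bounded_clinear B"
    and l: "l \<in> X" and m: "m \<in> X"
  shows "cmod (cinner (A (normalized_kernel ev l)) (B (normalized_kernel ev m))) \<le> onorm A * onorm B"
proof -
  have "norm (A (normalized_kernel ev l)) \<le> onorm A" "norm (B (normalized_kernel ev m)) \<le> onorm B"
    using onorm[of A "normalized_kernel ev l"] onorm[of B "normalized_kernel ev m"] A B
    by (simp_all add: bounded_clinear_def norm_normalized_kernel[OF rkhs] l m)
  then show ?thesis
    by (meson cmod_cinner_le mult_mono norm_ge_zero order_trans)
qed

text \<open>The left side is the diagonal entry of the supremum, which is finite because
  \<open>A\<close> is bounded.\<close>

lemma norm_le_berezin_norm_abs_op:
  assumes rkhs: "rkhs X ev" and A: "bounded_clinear A" and l: "l \<in> X"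
  shows "(norm (A (normalized_kernel ev l)))\<^sup>2 \<le> berezin_norm X ev (abs_op A ^^ 2)"
proof -
  let ?k = "normalized_kernel ev"
  have "bdd_above ((\<lambda>(l, m). cmod (cinner (A (?k l)) (A (?k m)))) ` (X \<times> X))"
    by (rule bdd_aboveI2[where M = "onorm A * onorm A"]) (auto intro: cmod_cinner_kernel_le[OF rkhs A A])
  then have "(case (l, l) of (l, m) \<Rightarrow> cmod (cinner (A (?k l)) (A (?k m))))
      \<le> (SUP (l, m)\<in>X \<times> X. cmod (cinner (A (?k l)) (A (?k m))))"
    by (intro cSUP_upper) (use l in auto)
  then show ?thesis
    by (simp add: berezin_norm_def abs_op_power2[OF A] cinner_cadjoint_left[OF A] cinner_self norm_power)
qed

text \<open>By Cauchy-Schwarz the off-diagonal entries are controlled by the norms on the diagonal.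
  Nonemptiness of \<open>X\<close> forces \<open>0 \<le> c\<close>.\<close>

lemma sqrt_berezin_norm_abs_op_le:
  assumes rkhs: "rkhs X ev" and A: "bounded_clinear A"
    and le: "\<And>l. l \<in> X \<Longrightarrow> norm (A (normalized_kernel ev l)) \<le> c"
  shows "sqrt (berezin_norm X ev (abs_op A ^^ 2)) \<le> c"
proof -
  let ?k = "normalized_kernel ev"
  have X: "X \<noteq> {}" using rkhs.nonempty[OF rkhs] .
  then have c: "0 \<le> c" using le norm_ge_zero order_trans by blast
  have "(SUP (l, m)\<in>X \<times> X. cmod (cinner (A (?k l)) (A (?k m)))) \<le> c * c"
  proof (rule cSUP_least)
    fix p assume "p \<in> X \<times> X"
    then obtain l m where p: "p = (l, m)" "l \<in> X" "m \<in> X" by blast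
    have "norm (A (?k l)) * norm (A (?k m)) \<le> c * c"
      using p c by (intro mult_mono le) auto
    then show "(case p of (l, m) \<Rightarrow> cmod (cinner (A (?k l)) (A (?k m)))) \<le> c * c"
      using cmod_cinner_le[of "A (?k l)" "A (?k m)"] by (simp add: p(1))
  qed (use X in simp)
  then show ?thesis
    using c by (intro real_le_lsqrt)
      (simp_all add: berezin_norm_def abs_op_power2[OF A] cinner_cadjoint_left[OF A] power2_eq_square)
qed

text \<open>Im z is the modulus times the sine of the argument, and sine increases on
  [-\<pi>/2, \<pi>/2].\<close>

lemma Im_le_sector:
  assumes "\<theta> < pi / 2" and z: "z \<in> sector \<theta>"
  shows "Im z \<le> sin \<theta> * cmod z"
proof -
  have "sin (Arg z) \<le> sin \<theta>"
    using assms by (intro sin_monotone_2pi_le) (auto simp: sector_def)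
  then show ?thesis
    using arg_cong[OF rcis_cmod_Arg[of z], of Im] mult_left_mono[of "sin (Arg z)" "sin \<theta>" "cmod z"]
    by (simp add: mult.commute)
qed

theorem theorem3p8:
  fixes X :: "'x set" and ev :: "'h::complex_hilbert \<Rightarrow> 'x \<Rightarrow> complex"
    and T S :: "'h \<Rightarrow> 'h" and \<theta> :: real
  assumes "rkhs X ev"
    and "bounded_clinear T" and "bounded_clinear S"
    and "0 \<le> \<theta>" and "\<theta> < pi / 2"
    and "cadjoint S \<circ> T \<in> berezin_sectorial X ev \<theta>"
    and "bij S" and "bounded_clinear (inv S)"
  shows "sqrt (berezin_norm X ev (abs_op T ^^ 2))
    \<le> onorm (inv S) * (sin \<theta> * berezin_number X ev (cadjoint S \<circ> T)
        + 1 / 2 * berezin_norm X ev (abs_op (\<lambda>x. T x - \<i> *\<^sub>C S x) ^^ 2))"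
proof -
  let ?k = "normalized_kernel ev" and ?D = "\<lambda>x. T x - \<i> *\<^sub>C S x"
  let ?R = "sin \<theta> * berezin_number X ev (cadjoint S \<circ> T) + 1 / 2 * berezin_norm X ev (abs_op ?D ^^ 2)"
  note rkhs = \<open>rkhs X ev\<close> and T = \<open>bounded_clinear T\<close> and S = \<open>bounded_clinear S\<close>
  have inv: "bounded_linear (inv S)"
    using \<open>bounded_clinear (inv S)\<close> by (simp add: bounded_clinear_def)
  have D: "bounded_clinear ?D"
    unfolding bounded_clinear_def
  proof (intro conjI allI)
    show "bounded_linear ?D"
      using T S by (auto simp: bounded_clinear_def
          intro: bounded_linear_sub bounded_linear_compose[OF bounded_linear_scaleC])
    show "?D (c *\<^sub>C x) = c *\<^sub>C ?D x" for c x
      using T S by (simp add: bounded_clinear_def scaleC_scaleC mult.commute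
          linear_simps[OF bounded_linear_scaleC])
  qed
  have transform: "berezin_transform ev (cadjoint S \<circ> T) l = cinner (T (?k l)) (S (?k l))" for l
    by (simp add: berezin_transform_def cinner_cadjoint_left[OF S])
  have "norm (T (?k l)) \<le> onorm (inv S) * ?R" if l: "l \<in> X" for l
  proof -
    define t s z where "t = norm (T (?k l))" and "s = norm (S (?k l))"
      and "z = cinner (T (?k l)) (S (?k l))"
    have "z \<in> sector \<theta>"
      using assms(6) l by (auto simp: berezin_sectorial_def berezin_range_def z_def transform)
    then have "Im z \<le> sin \<theta> * cmod z"
      using \<open>\<theta> < pi / 2\<close> by (intro Im_le_sector)
    \<comment> \<open>A real supremum bounds its family only if the family is bounded above;
      \<open>onorm T * onorm S\<close> is such a bound.\<close>
    also have "cmod z \<le> berezin_number X ev (cadjoint S \<circ> T)"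
      unfolding berezin_number_def transform z_def
      by (intro cSUP_upper l bdd_aboveI2[where M = "onorm T * onorm S"] cmod_cinner_kernel_le[OF rkhs T S])
    then have "sin \<theta> * cmod z \<le> sin \<theta> * berezin_number X ev (cadjoint S \<circ> T)"
      using assms(4,5) by (intro mult_left_mono) (auto intro: sin_ge_zero)
    finally have Im: "Im z \<le> sin \<theta> * berezin_number X ev (cadjoint S \<circ> T)" .
    have "(norm (?D (?k l)))\<^sup>2 = t\<^sup>2 + s\<^sup>2 - 2 * Im z"
    proof -
      \<comment> \<open>Conjugate linearity in the second argument produces -\<i>z, whose real part
        is Im z.\<close>
      have "inner (T (?k l)) (\<i> *\<^sub>C S (?k l)) = Im z"
        by (simp add: z_def inner_cinner cinner_scaleC_right)
      moreover have "(norm (\<i> *\<^sub>C S (?k l)))\<^sup>2 = s\<^sup>2" by (simp add: s_def norm_scaleC)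
      moreover have "(norm (x - y))\<^sup>2 = (norm x)\<^sup>2 + (norm y)\<^sup>2 - 2 * inner x y" for x y :: 'h
        by (simp add: power2_norm_eq_inner inner_diff_left inner_diff_right inner_commute)
      ultimately show ?thesis by (simp add: t_def)
    qed
    moreover have "(norm (?D (?k l)))\<^sup>2 \<le> berezin_norm X ev (abs_op ?D ^^ 2)"
      by (rule norm_le_berezin_norm_abs_op[OF rkhs D l])
    \<comment> \<open>This gives \<open>2 * t * s \<le> t\<^sup>2 + s\<^sup>2\<close>, and the right
      side is the squared norm of \<open>?D (?k l)\<close> plus \<open>2 * Im z\<close>.\<close>
    moreover have "0 \<le> (t - s)\<^sup>2" by simp
    ultimately have ts: "t * s \<le> ?R" using Im by (simp add: power2_diff)
    have "1 = norm (inv S (S (?k l)))"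
      using \<open>bij S\<close> by (simp add: bij_is_inj norm_normalized_kernel[OF rkhs l])
    also have "\<dots> \<le> onorm (inv S) * s" unfolding s_def by (rule onorm[OF inv])
    finally have "t * 1 \<le> t * (onorm (inv S) * s)" by (intro mult_left_mono) (simp_all add: t_def)
    also have "\<dots> = onorm (inv S) * (t * s)" by simp
    also have "\<dots> \<le> onorm (inv S) * ?R" by (intro mult_left_mono ts onorm_pos_le[OF inv])
    finally show ?thesis by (simp add: t_def)
  qed
  then show ?thesis by (rule sqrt_berezin_norm_abs_op_le[OF rkhs T])
qed

end
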